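(* Let $\mathcal{H}_A,\mathcal{H}_B$ be complex Hilbert spaces of finite dimensions $d_A,d_B\ge 2$, and let $f$ be the function on $[0,D_A]\times[0,D_B]$ defined in the context. Then every density operator $\rho_{AB}$ on $\mathcal{H}_A\otimes\mathcal{H}_B$ satisfies $$S_L(\rho_{AB})\le f\big(S_L(\rho_A),S_L(\rho_B)\big),$$ and this inequality is tight, i.e. for every $(a,b)\in[0,D_A]\times[0,D_B]$ there is a density operator $\rho_{AB}$ on $\mathcal{H}_A\otimes\mathcal{H}_B$ with $S_L(\rho_A)=a$, $S_L(\rho_B)=b$ and $S_L(\rho_{AB})=f(a,b)$.
   Context: A density operator (state) is a positive semidefinite operator of trace $1$. The linear entropy is $S_L(\rho)=1-\operatorname{Tr}(\rho^2)$. The reduced states are the partial traces $\rho_A=\operatorname{Tr}_B(\rho_{AB})$, $\rho_B=\operatorname{Tr}_A(\rho_{AB})$. Put $D_A=\frac{d_A-1}{d_A}$, $D_B=\frac{d_B-1}{d_B}$. For $(x,y)\in[0,D_A]\times[0,D_B]$ define $$h(x,y)=\frac{1}{d_B}x+\frac{1}{d_A}y+D_AD_B,$$ $$g(x,y)=x+y-2D_AD_B\Big(1-\sqrt{1-\tfrac{x}{D_A}}\Big)\Big(1-\sqrt{1-\tfrac{y}{D_B}}\Big),$$ $$r(y)=D_A\Big(\tfrac{y}{D_B}-1+2\sqrt{1-\tfrac{y}{D_B}}\Big),$$ and $f(x,y)=g(x,y)$ if $x\le r(y)$, $f(x,y)=h(x,y)$ if $x>r(y)$. *)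

theory Defs
  imports "HOL-Analysis.Analysis"
begin

text \<open>
  A finite-dimensional complex Hilbert space is represented, in an orthonormal basis, as
  \<^typ>\<open>complex ^ 'n\<close> with \<^term>\<open>CARD('n)\<close> as its dimension, and an operator on it as a square
  matrix acting by \<open>*v\<close>.  The tensor product of the spaces with index types \<open>'a\<close> and \<open>'b\<close>
  has index type \<open>'a \<times> 'b\<close>; the index \<open>(i, k)\<close> stands for the product basis vector
  \<open>e\<^sub>i \<otimes> e\<^sub>k\<close>.
\<close>

text \<open>The operator \<open>\<bullet>\<close> of the library is the real inner product, even on complex vectors.\<close>

definition cinner :: "complex ^ 'n \<Rightarrow> complex ^ 'n \<Rightarrow> complex" where
  "cinner v w = (\<Sum>i\<in>UNIV. cnj (v $ i) * w $ i)"

text \<open>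
  Over the complex numbers, \<open>\<langle>v, M v\<rangle> \<ge> 0\<close> for all \<open>v\<close> already forces \<open>M\<close> to be Hermitian;
  membership in \<open>\<real>\<^sub>\<ge>\<^sub>0\<close> includes that the number is real.
\<close>

definition positive_semidefinite :: "complex ^ 'n ^ 'n \<Rightarrow> bool" where
  "positive_semidefinite M \<longleftrightarrow> (\<forall>v. cinner v (M *v v) \<in> \<real>\<^sub>\<ge>\<^sub>0)"

definition density_operator :: "complex ^ 'n ^ 'n \<Rightarrow> bool" where
  "density_operator \<rho> \<longleftrightarrow> positive_semidefinite \<rho> \<and> trace \<rho> = 1"

text \<open>The trace of \<open>\<rho>\<^sup>2\<close> is real for Hermitian \<open>\<rho>\<close>, so \<^const>\<open>Re\<close> only changes the type.\<close>

definition linear_entropy :: "complex ^ 'n ^ 'n \<Rightarrow> real" where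
  "linear_entropy \<rho> = 1 - Re (trace (\<rho> ** \<rho>))"

definition partial_trace_B ::
  "complex ^ ('a::finite \<times> 'b::finite) ^ ('a \<times> 'b) \<Rightarrow> complex ^ 'a ^ 'a" where
  "partial_trace_B \<rho> = (\<chi> i j. \<Sum>k\<in>UNIV. \<rho> $ (i, k) $ (j, k))"

definition partial_trace_A ::
  "complex ^ ('a::finite \<times> 'b::finite) ^ ('a \<times> 'b) \<Rightarrow> complex ^ 'b ^ 'b" where
  "partial_trace_A \<rho> = (\<chi> k l. \<Sum>i\<in>UNIV. \<rho> $ (i, k) $ (i, l))"

definition D :: "nat \<Rightarrow> real" where
  "D d = (real d - 1) / real d"

definition h_bound :: "nat \<Rightarrow> nat \<Rightarrow> real \<Rightarrow> real \<Rightarrow> real" where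
  "h_bound dA dB x y = 1 / real dB * x + 1 / real dA * y + D dA * D dB"

definition g_bound :: "nat \<Rightarrow> nat \<Rightarrow> real \<Rightarrow> real \<Rightarrow> real" where
  "g_bound dA dB x y =
     x + y - 2 * D dA * D dB * (1 - sqrt (1 - x / D dA)) * (1 - sqrt (1 - y / D dB))"

definition r_bound :: "nat \<Rightarrow> nat \<Rightarrow> real \<Rightarrow> real" where
  "r_bound dA dB y = D dA * (y / D dB - 1 + 2 * sqrt (1 - y / D dB))"

text \<open>Only the values on \<open>{0..D dA} \<times> {0..D dB}\<close> are meaningful.\<close>

definition f_bound :: "nat \<Rightarrow> nat \<Rightarrow> real \<Rightarrow> real \<Rightarrow> real" where
  "f_bound dA dB x y = (if x \<le> r_bound dA dB y then g_bound dA dB x y else h_bound dA dB x y)"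

end

theory Submission imports Defs begin

text \<open>
  Write \<open>\<rho> = I / (dA dB) + \<alpha> \<otimes> I / dB + I / dA \<otimes> \<beta> + \<gamma>\<close> with \<open>\<alpha>\<close>, \<open>\<beta>\<close> the traceless parts of the
  marginals; the four terms are orthogonal, so \<open>S\<^sub>L \<rho> = h - (norm \<gamma>)\<^sup>2\<close>.  Put
  \<open>u = norm \<alpha> / sqrt D\<^sub>A\<close> and \<open>v = norm \<beta> / sqrt D\<^sub>B\<close>.  A traceless Hermitian \<open>\<alpha>\<close> satisfies
  \<open>\<alpha> \<le> D\<^sub>A u I\<close>, hence \<open>(D\<^sub>A u I - \<alpha>) \<otimes> (D\<^sub>B v I - \<beta>)\<close> is positive and has a nonnegative inner
  product with \<open>\<rho>\<close>.  Expanded, this says \<open>\<langle>\<gamma>, \<alpha> \<otimes> \<beta>\<rangle> \<ge> D\<^sub>A D\<^sub>B u v (u + v - 1)\<close>, and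
  Cauchy--Schwarz gives \<open>(norm \<gamma>)\<^sup>2 \<ge> D\<^sub>A D\<^sub>B (u + v - 1)\<^sup>2 = h - g\<close> when \<open>u + v \<ge> 1\<close>.
  Diagonal states whose \<open>\<alpha>\<close>, \<open>\<beta>\<close> are multiples of the traceless part of a rank-one projection
  attain equality.
\<close>

section \<open>Positive semidefinite matrices\<close>

definition hermitian :: "complex ^ 'n ^ 'n \<Rightarrow> bool" where
  "hermitian M \<longleftrightarrow> (\<forall>i j. M $ i $ j = cnj (M $ j $ i))"

definition outer :: "complex ^ 'n \<Rightarrow> complex ^ 'n ^ 'n" where
  "outer w = (\<chi> i j. w $ i * cnj (w $ j))"

text \<open>The library's real inner product and norm on matrices are the real part of the
  Hilbert--Schmidt inner product and its norm.\<close>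

lemma inner_complex_vec: "v \<bullet> w = Re (\<Sum>i\<in>UNIV. v $ i * cnj (w $ i))"
  for v w :: "complex ^ 'n"
  by (simp add: inner_vec_def inner_complex_def)

lemma inner_complex_matrix: "A \<bullet> B = Re (\<Sum>i\<in>UNIV. \<Sum>j\<in>UNIV. A $ i $ j * cnj (B $ i $ j))"
  for A B :: "complex ^ 'n ^ 'm"
  by (simp add: inner_vec_def inner_complex_def)

text \<open>Conjugating an entry of a Hermitian B transposes it, so the entrywise sum becomes a
  matrix product. With A = B the purity is a squared norm.\<close>

lemma inner_hermitian:
  assumes "hermitian B"
  shows "A \<bullet> B = Re (trace (A ** B))"
proof -
  have "cnj (B $ i $ j) = B $ j $ i" for i j
    using assms unfolding hermitian_def by metis
  then show ?thesis
    by (simp add: inner_complex_matrix trace_def matrix_matrix_mult_def)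
qed

lemma linear_entropy_eq_norm:
  assumes "hermitian M"
  shows "linear_entropy M = 1 - (norm M)\<^sup>2"
  using assms by (simp add: linear_entropy_def power2_norm_eq_inner inner_hermitian)

lemma hermitian_diff: "hermitian A \<Longrightarrow> hermitian B \<Longrightarrow> hermitian (A - B)"
  unfolding hermitian_def by (metis complex_cnj_diff vector_minus_component)

lemma hermitian_scaleR_mat_1: "hermitian (c *\<^sub>R mat 1)"
  by (simp add: hermitian_def mat_def)

section \<open>The sesquilinear form of a matrix\<close>

lemma cinner_matrix: "cinner v (M *v w) = (\<Sum>i\<in>UNIV. \<Sum>j\<in>UNIV. cnj (v $ i) * M $ i $ j * w $ j)"
  by (simp add: cinner_def matrix_vector_mult_def sum_distrib_left mult.assoc)

lemma Re_cinner_matrix: "Re (cinner v (M *v v)) = M \<bullet> outer v"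
  by (simp add: cinner_matrix inner_complex_matrix outer_def mult_ac)

lemma cinner_add_left: "cinner (v + w) z = cinner v z + cinner w z"
  by (simp add: cinner_def algebra_simps sum.distrib)

lemma cinner_add_right: "cinner z (v + w) = cinner z v + cinner z w"
  by (simp add: cinner_def algebra_simps sum.distrib)

lemma cinner_diff_right: "cinner z (v - w) = cinner z v - cinner z w"
  by (simp add: cinner_def algebra_simps sum_subtractf)

lemma cinner_scale_left: "cinner (c *s v) z = cnj c * cinner v z"
  by (simp add: cinner_def sum_distrib_left mult_ac)

lemma cinner_scale_right: "cinner z (c *s v) = c * cinner z v"
  by (simp add: cinner_def sum_distrib_left mult_ac)

lemma cnj_cinner: "cnj (cinner v w) = cinner w v"
  by (simp add: cinner_def mult.commute)

lemma cinner_axis: "cinner (axis i 1) w = w $ i"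
proof -
  have "cinner (axis i 1) w = (\<Sum>j\<in>UNIV. if j = i then w $ j else 0)"
    unfolding cinner_def axis_def by (intro sum.cong) auto
  then show ?thesis by simp
qed

lemma matrix_vector_axis: "(M *v axis j 1) $ i = M $ i $ j" for M :: "complex ^ 'n ^ 'n"
proof -
  have "(M *v axis j 1) $ i = (\<Sum>k\<in>UNIV. if k = j then M $ i $ k else 0)"
    unfolding matrix_vector_mult_def axis_def vec_lambda_beta by (intro sum.cong) auto
  then show ?thesis by simp
qed

lemma cinner_scale_add:
  "cinner (v + c *s w) (M *v (v + c *s w)) =
    cinner v (M *v v) + c * cinner v (M *v w) + cnj c * cinner w (M *v v)
      + c * cnj c * cinner w (M *v w)"
  by (simp add: cinner_add_left cinner_add_right cinner_scale_left cinner_scale_right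
      matrix_vector_right_distrib vector_scalar_commute algebra_simps)

lemma psd_quadratic:
  assumes "positive_semidefinite M"
  shows "Re (cinner v (M *v v)) \<ge> 0" "Im (cinner v (M *v v)) = 0"
  using assms by (auto simp: positive_semidefinite_def complex_nonneg_Reals_iff)

lemma psdI:
  assumes "\<And>v. Re (cinner v (M *v v)) \<ge> 0" "\<And>v. Im (cinner v (M *v v)) = 0"
  shows "positive_semidefinite M"
  using assms by (auto simp: positive_semidefinite_def complex_nonneg_Reals_iff)

text \<open>Polarization: the form is real at v, at w and at every v + c w, so the cross terms have
  zero imaginary part for every complex c.\<close>

lemma psd_sesquilinear_symmetric:
  assumes "positive_semidefinite M"
  shows "cinner v (M *v w) = cnj (cinner w (M *v v))"
proof -
  have "Im (c * cinner v (M *v w) + cnj c * cinner w (M *v v)) = 0" for c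
    using psd_quadratic(2)[OF assms, of "v + c *s w"] psd_quadratic(2)[OF assms, of v]
      psd_quadratic(2)[OF assms, of w]
    by (simp add: cinner_scale_add)
  \<comment> \<open>c = 1 relates the imaginary parts of the two values, c = i their real
    parts.\<close>
  from this[of 1] this[of \<i>] show ?thesis
    by (simp add: complex_eq_iff)
qed

lemma psd_hermitian:
  assumes "positive_semidefinite M"
  shows "hermitian M"
  unfolding hermitian_def
proof (intro allI)
  fix i j
  show "M $ i $ j = cnj (M $ j $ i)"
    using psd_sesquilinear_symmetric[OF assms, of "axis i 1" "axis j 1"]
    unfolding cinner_axis matrix_vector_axis .
qed

lemma hermitian_quadratic_real:
  assumes "hermitian M"
  shows "Im (cinner v (M *v v)) = 0"
proof -
  have M: "cnj (M $ i $ j) = M $ j $ i" for i j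
    using assms unfolding hermitian_def by metis
  have "cnj (cinner v (M *v v)) = (\<Sum>i\<in>UNIV. \<Sum>j\<in>UNIV. v $ i * M $ j $ i * cnj (v $ j))"
    by (simp add: cinner_matrix M)
  also have "\<dots> = cinner v (M *v v)"
    unfolding cinner_matrix by (subst sum.swap) (simp add: mult_ac)
  finally show ?thesis
    by (simp add: complex_eq_iff)
qed

lemma psd_Cauchy_Schwarz:
  assumes "positive_semidefinite M"
  shows "(cmod (cinner v (M *v w)))\<^sup>2 \<le> Re (cinner v (M *v v)) * Re (cinner w (M *v w))"
proof -
  define z where "z = cinner v (M *v w)"
  define p q where "p = Re (cinner v (M *v v))" and "q = Re (cinner w (M *v w))"
  have q: "q \<ge> 0"
    unfolding q_def by (rule psd_quadratic(1)[OF assms])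
  \<comment> \<open>The form is evaluated at v - t cnj(z) w with t real; the factor cnj(z) turns
    both cross terms into - t |z|^2.\<close>
  have ineq: "0 \<le> p - 2 * t * (cmod z)\<^sup>2 + t\<^sup>2 * (cmod z)\<^sup>2 * q" for t
  proof -
    have w: "cinner w (M *v v) = cnj z"
      using psd_sesquilinear_symmetric[OF assms] unfolding z_def by blast
    have qq: "cinner w (M *v w) = of_real q"
      using psd_quadratic(2)[OF assms, of w] by (simp add: q_def complex_eq_iff)
    have "0 \<le> Re (cinner (v + (- of_real t * cnj z) *s w) (M *v (v + (- of_real t * cnj z) *s w)))"
      by (rule psd_quadratic(1)[OF assms])
    also have "\<dots> = p - 2 * t * (cmod z)\<^sup>2 + t\<^sup>2 * (cmod z)\<^sup>2 * q"
      unfolding cinner_scale_add w qq z_def[symmetric]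
      by (simp add: p_def cmod_power2) (simp add: algebra_simps power2_eq_square)
    finally show ?thesis .
  qed
  have "(cmod z)\<^sup>2 \<le> p * q"
  proof (cases "q = 0")
    case True
    have "(cmod z)\<^sup>2 = 0"
    proof (rule ccontr)
      assume nz: "(cmod z)\<^sup>2 \<noteq> 0"
      \<comment> \<open>For q = 0 the bound is affine in t with nonzero slope; this t makes its
        right side - 1.\<close>
      show False
        using ineq[of "(p + 1) / (2 * (cmod z)\<^sup>2)"] nz True by (simp add: field_simps)
    qed
    then show ?thesis using True by simp
  next
    case False
    then have "q > 0" using q by simp
    \<comment> \<open>t = 1 / q minimizes the quadratic in \<open>ineq\<close>.\<close>
    then have "0 \<le> p - (cmod z)\<^sup>2 / q"
      using ineq[of "1 / q"] by (simp add: power2_eq_square field_simps)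
    then show ?thesis using \<open>q > 0\<close> by (simp add: field_simps)
  qed
  then show ?thesis by (simp add: z_def p_def q_def)
qed

section \<open>Rank-one matrices and Cholesky elimination\<close>

lemma cinner_outer: "cinner v (outer w *v v) = (cmod (cinner v w))\<^sup>2"
proof -
  have "cinner v (outer w *v v) = cinner v w * cnj (cinner v w)"
    unfolding cinner_matrix
    unfolding cinner_def cnj_sum complex_cnj_mult sum_product
    by (simp add: outer_def mult_ac)
  then show ?thesis by (simp add: complex_norm_square del: of_real_power)
qed

text \<open>Cholesky elimination: subtracting a suitable \<open>outer w\<close> kills one nonzero diagonal entry.\<close>

lemma psd_induct [consumes 1, case_names zero add]:
  fixes M :: "complex ^ 'n ^ 'n"
  assumes "positive_semidefinite M"
    and zero: "P 0"
    and add: "\<And>M w. positive_semidefinite M \<Longrightarrow> P M \<Longrightarrow> P (M + outer w)"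
  shows "P M"
  using assms(1)
\<comment> \<open>Counting nonzero diagonal entries suffices: by \<open>entry\<close> below, a zero
  diagonal forces M = 0.\<close>
proof (induction "card {i. M $ i $ i \<noteq> 0}" arbitrary: M rule: less_induct)
  case less
  note psd = less.prems
  have entry: "(cmod (M $ i $ j))\<^sup>2 \<le> Re (M $ i $ i) * Re (M $ j $ j)" for i j
    using psd_Cauchy_Schwarz[OF psd, of "axis i 1" "axis j 1"]
    by (simp add: cinner_axis matrix_vector_axis)
  show ?case
  proof (cases "\<forall>i. M $ i $ i = 0")
    case True
    have "M $ i $ j = 0" for i j
      using entry[of i j] True by simp
    then have "M = 0"
      by (simp add: vec_eq_iff)
    then show ?thesis using zero by simp
  next
    case False
    then obtain i where i: "M $ i $ i \<noteq> 0" by blast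
    define m where "m = Re (M $ i $ i)"
    have Mii: "M $ i $ i = of_real m"
      using psd_quadratic(2)[OF psd, of "axis i 1"]
      by (simp add: m_def complex_eq_iff cinner_axis matrix_vector_axis)
    have m: "m > 0"
      using psd_quadratic(1)[OF psd, of "axis i 1"] i Mii
      by (simp add: cinner_axis matrix_vector_axis)
    \<comment> \<open>Column i is scaled by 1 / sqrt m so that \<open>outer w\<close> agrees with M
      at (i, i).\<close>
    define w where "w = of_real (1 / sqrt m) *s (M *v axis i 1)"
    have w: "w $ j * cnj (w $ j) = of_real ((cmod (M $ j $ i))\<^sup>2 / m)" for j
      using m unfolding complex_norm_square[symmetric] w_def
      by (simp add: matrix_vector_axis norm_mult norm_divide power_divide)
    have psd': "positive_semidefinite (M - outer w)"
    proof (rule psdI)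
      fix v
      have eq: "cinner v ((M - outer w) *v v) = cinner v (M *v v) - of_real ((cmod (cinner v w))\<^sup>2)"
        by (simp add: cinner_outer matrix_vector_mult_diff_rdistrib cinner_diff_right)
      \<comment> \<open>Positivity of the remainder is exactly Cauchy-Schwarz for the form of M at v
        and the i-th basis vector.\<close>
      have "(cmod (cinner v w))\<^sup>2 = (cmod (cinner v (M *v axis i 1)))\<^sup>2 / m"
        using m by (simp add: w_def cinner_scale_right norm_mult norm_divide power_divide)
      also have "\<dots> \<le> Re (cinner v (M *v v))"
        using psd_Cauchy_Schwarz[OF psd, of v "axis i 1"] m
        by (simp add: cinner_axis matrix_vector_axis m_def field_simps)
      finally show "Re (cinner v ((M - outer w) *v v)) \<ge> 0"
        by (simp add: eq)
      show "Im (cinner v ((M - outer w) *v v)) = 0"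
        using psd_quadratic(2)[OF psd] by (simp add: eq)
    qed
    have "(M - outer w) $ i $ i = 0"
      using m by (simp add: outer_def w Mii power2_eq_square)
    \<comment> \<open>If diagonal entry j is zero, \<open>entry\<close> makes M vanish at (j, i), so
      elimination leaves that diagonal entry zero.\<close>
    moreover have "(M - outer w) $ j $ j = 0" if "M $ j $ j = 0" for j
      using entry[of j i] that by (simp add: outer_def w)
    ultimately have "{j. (M - outer w) $ j $ j \<noteq> 0} \<subset> {j. M $ j $ j \<noteq> 0}"
      using i by blast
    then have "P (M - outer w)"
      using less.hyps psd' by (simp add: psubset_card_mono)
    from add[OF psd' this, of w] show ?thesis by simp
  qed
qed

lemma outer_inner_outer: "outer v \<bullet> outer w = (cmod (cinner v w))\<^sup>2"
  using arg_cong[OF cinner_outer[of w v], of Re] cnj_cinner[of v w]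
  by (simp add: Re_cinner_matrix) (metis complex_mod_cnj)

lemma cinner_self: "cinner v v = of_real ((norm v)\<^sup>2)"
  by (simp add: complex_eq_iff cinner_def power2_norm_eq_inner inner_vec_def inner_complex_def)

lemma norm_outer: "norm (outer v) = (norm v)\<^sup>2"
proof -
  have "(norm (outer v))\<^sup>2 = ((norm v)\<^sup>2)\<^sup>2"
    by (simp add: power2_norm_eq_inner[of "outer v"] outer_inner_outer cinner_self norm_power)
  then show ?thesis by (rule power2_eq_imp_eq) auto
qed

lemma inner_mat_1: "A \<bullet> mat 1 = Re (trace A)" for A :: "complex ^ 'n ^ 'n"
proof -
  have "(\<Sum>j\<in>UNIV. A $ i $ j * cnj (mat 1 $ i $ j)) = A $ i $ i" for i
  proof -
    have "(\<Sum>j\<in>UNIV. A $ i $ j * cnj (mat 1 $ i $ j)) = (\<Sum>j\<in>UNIV. if i = j then A $ i $ j else 0)"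
      by (intro sum.cong) (auto simp: mat_def)
    then show ?thesis by simp
  qed
  then show ?thesis by (simp add: inner_complex_matrix trace_def)
qed

lemma trace_scaleR: "trace (c *\<^sub>R A) = c *\<^sub>R trace A"
  by (simp add: trace_def scaleR_sum_right)

lemma trace_mat_1: "trace (mat 1 :: complex ^ 'n ^ 'n) = of_nat CARD('n)"
  by (simp add: trace_def mat_def)

lemma trace_outer: "Re (trace (outer v)) = (norm v)\<^sup>2"
  by (simp add: trace_def outer_def power2_norm_eq_inner inner_complex_vec)

text \<open>Norm and trace agree on rank-one terms, and the triangle inequality carries the bound
  through their sum. For states this bounds the purity by 1.\<close>

lemma psd_norm_le_trace:
  assumes "positive_semidefinite M"
  shows "norm M \<le> Re (trace M)"
  using assms
proof (induction rule: psd_induct)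
  case zero
  then show ?case by (simp add: trace_def)
next
  case (add M w)
  have "norm (M + outer w) \<le> norm M + norm (outer w)"
    by (rule norm_triangle_ineq)
  also have "\<dots> \<le> Re (trace (M + outer w))"
    using add.IH by (simp add: norm_outer trace_outer trace_add)
  finally show ?case .
qed

text \<open>Cauchy--Schwarz against the traceless part of \<open>outer v\<close>, whose norm is
  \<open>sqrt (D d) * (norm v)\<^sup>2\<close>.\<close>

lemma traceless_le_norm_psd:
  fixes A :: "complex ^ 'n ^ 'n"
  assumes herm: "hermitian A" and tr: "Re (trace A) = 0"
  shows "positive_semidefinite ((sqrt (D CARD('n)) * norm A) *\<^sub>R mat 1 - A)"
proof (rule psdI)
  fix v :: "complex ^ 'n"
  let ?S = "(sqrt (D CARD('n)) * norm A) *\<^sub>R mat 1 - A"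
  show "Im (cinner v (?S *v v)) = 0"
    by (intro hermitian_quadratic_real hermitian_diff hermitian_scaleR_mat_1 herm)
  define d where "d = real CARD('n)"
  have d: "d > 0" by (simp add: d_def)
  define P where "P = outer v - ((norm v)\<^sup>2 / d) *\<^sub>R mat 1"
  have I: "(mat 1 :: complex ^ 'n ^ 'n) \<bullet> mat 1 = d"
    by (simp only: inner_mat_1) (simp add: trace_mat_1 d_def)
  have N: "outer v \<bullet> outer v = ((norm v)\<^sup>2)\<^sup>2"
    by (simp add: power2_norm_eq_inner[symmetric] norm_outer)
  have "P \<bullet> P = D CARD('n) * ((norm v)\<^sup>2)\<^sup>2"
    using d unfolding P_def inner_diff_left inner_diff_right
    by (simp add: inner_mat_1 trace_outer trace_scaleR trace_mat_1 I inner_commute[of "mat 1" "outer v"] N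
        D_def d_def[symmetric] field_simps power2_eq_square)
  then have P: "norm P = sqrt (D CARD('n)) * (norm v)\<^sup>2"
    by (simp add: norm_eq_sqrt_inner real_sqrt_mult)
  \<comment> \<open>A is orthogonal to the identity, so \<open>outer v\<close> may be replaced by
    its traceless part; this gains the factor \<open>sqrt (D d)\<close> over plain
    Cauchy-Schwarz.\<close>
  have "A \<bullet> outer v = A \<bullet> P"
    by (simp add: P_def inner_diff_right inner_mat_1 tr)
  also have "\<dots> \<le> norm A * norm P"
    by (rule norm_cauchy_schwarz)
  finally show "Re (cinner v (?S *v v)) \<ge> 0"
    unfolding Re_cinner_matrix
    by (simp add: inner_diff_left inner_commute[of "mat 1"] inner_mat_1 trace_outer P mult_ac)
qed

section \<open>Kronecker products and partial traces\<close>

definition kron :: "complex ^ 'a::finite ^ 'a \<Rightarrow> complex ^ 'b::finite ^ 'b \<Rightarrow>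
    complex ^ ('a \<times> 'b) ^ ('a \<times> 'b)" where
  "kron S T = (\<chi> p q. S $ fst p $ fst q * T $ snd p $ snd q)"

lemma sum_UNIV_prod:
  "(\<Sum>p\<in>UNIV. f p) = (\<Sum>i\<in>UNIV. \<Sum>k\<in>UNIV. f (i, k))"
  for f :: "'a::finite \<times> 'b::finite \<Rightarrow> 'c::comm_monoid_add"
  by (simp add: sum.cartesian_product)

lemma bilinear_kron: "bilinear kron"
  by (auto simp: bilinear_def linear_iff kron_def vec_eq_iff algebra_simps)

lemmas kron_simps =
  bilinear_ladd[OF bilinear_kron] bilinear_radd[OF bilinear_kron]
  bilinear_lsub[OF bilinear_kron] bilinear_rsub[OF bilinear_kron]
  bilinear_lmul[OF bilinear_kron] bilinear_rmul[OF bilinear_kron]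
  bilinear_lzero[OF bilinear_kron] bilinear_rzero[OF bilinear_kron]

lemma kron_mat_1: "kron (mat 1) (mat 1) = mat 1"
  by (auto simp: kron_def mat_def vec_eq_iff)

lemma kron_outer: "kron (outer v) (outer w) = outer (\<chi> p. v $ fst p * w $ snd p)"
  by (simp add: kron_def outer_def vec_eq_iff mult_ac)

lemma norm_kron: "norm (kron S T) = norm S * norm T"
proof -
  have norm2: "(norm A)\<^sup>2 = (\<Sum>i\<in>UNIV. \<Sum>j\<in>UNIV. (cmod (A $ i $ j))\<^sup>2)" for A :: "complex ^ 'm ^ 'm"
    by (simp add: power2_norm_eq_inner inner_vec_def)
  have "(norm (kron S T))\<^sup>2 = (norm S * norm T)\<^sup>2"
    unfolding power_mult_distrib norm2
    by (simp add: sum_UNIV_prod kron_def norm_mult power_mult_distrib sum_product)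
  then show ?thesis by (rule power2_eq_imp_eq) auto
qed

text \<open>Splitting both factors into rank-one terms leaves quadratic forms of \<rho> at product
  vectors, each nonnegative.\<close>

lemma psd_inner_kron_nonneg:
  assumes "positive_semidefinite \<rho>" "positive_semidefinite S" "positive_semidefinite T"
  shows "\<rho> \<bullet> kron S T \<ge> 0"
  using assms(2)
proof (induction rule: psd_induct)
  case zero
  then show ?case by (simp add: kron_simps)
next
  case (add S s)
  have "\<rho> \<bullet> kron (outer s) T \<ge> 0"
    using assms(3)
  proof (induction rule: psd_induct)
    case zero
    then show ?case by (simp add: kron_simps)
  next
    case (add T t)
    then show ?case
      using psd_quadratic(1)[OF assms(1)]
      by (simp add: kron_simps inner_add_right kron_outer Re_cinner_matrix)
  qed
  with add show ?case by (simp add: kron_simps inner_add_right)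
qed

section \<open>Partial traces\<close>

lemma partial_trace_B_kron: "partial_trace_B (kron S T) $ i $ j = trace T * S $ i $ j"
  by (simp add: partial_trace_B_def kron_def trace_def sum_distrib_left mult.commute)

lemma partial_trace_A_kron: "partial_trace_A (kron S T) $ k $ l = trace S * T $ k $ l"
  by (simp add: partial_trace_A_def kron_def trace_def sum_distrib_right)

lemma trace_partial_trace_B: "trace (partial_trace_B \<rho>) = trace \<rho>"
  by (simp add: trace_def partial_trace_B_def sum_UNIV_prod)

lemma trace_partial_trace_A: "trace (partial_trace_A \<rho>) = trace \<rho>"
  unfolding trace_def partial_trace_A_def sum_UNIV_prod
  by (subst sum.swap) simp

text \<open>The partial trace is the adjoint of tensoring with the identity.\<close>

lemma inner_kron_mat_1_right: "\<rho> \<bullet> kron S (mat 1) = partial_trace_B \<rho> \<bullet> S"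
proof -
  have "(\<Sum>l\<in>UNIV. \<rho> $ (i, k) $ (j, l) * cnj (S $ i $ j * mat 1 $ k $ l))
      = \<rho> $ (i, k) $ (j, k) * cnj (S $ i $ j)" for i j k
  proof -
    have "(\<Sum>l\<in>UNIV. \<rho> $ (i, k) $ (j, l) * cnj (S $ i $ j * mat 1 $ k $ l))
        = (\<Sum>l\<in>UNIV. if k = l then \<rho> $ (i, k) $ (j, l) * cnj (S $ i $ j) else 0)"
      by (intro sum.cong) (auto simp: mat_def)
    then show ?thesis by simp
  qed
  then have "(\<Sum>p\<in>UNIV. \<Sum>q\<in>UNIV. \<rho> $ p $ q * cnj (kron S (mat 1) $ p $ q))
      = (\<Sum>i\<in>UNIV. \<Sum>k\<in>UNIV. \<Sum>j\<in>UNIV. \<rho> $ (i, k) $ (j, k) * cnj (S $ i $ j))"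
    by (simp add: sum_UNIV_prod kron_def)
  also have "\<dots> = (\<Sum>i\<in>UNIV. \<Sum>j\<in>UNIV. \<Sum>k\<in>UNIV. \<rho> $ (i, k) $ (j, k) * cnj (S $ i $ j))"
    by (rule sum.cong[OF refl], rule sum.swap)
  also have "\<dots> = (\<Sum>i\<in>UNIV. \<Sum>j\<in>UNIV. partial_trace_B \<rho> $ i $ j * cnj (S $ i $ j))"
    by (simp add: partial_trace_B_def sum_distrib_right)
  finally show ?thesis by (simp add: inner_complex_matrix)
qed

lemma inner_kron_mat_1_left: "\<rho> \<bullet> kron (mat 1) T = partial_trace_A \<rho> \<bullet> T"
proof -
  have "(\<Sum>j\<in>UNIV. \<Sum>l\<in>UNIV. \<rho> $ (i, k) $ (j, l) * cnj (mat 1 $ i $ j * T $ k $ l))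
      = (\<Sum>l\<in>UNIV. \<rho> $ (i, k) $ (i, l) * cnj (T $ k $ l))" for i k
  proof -
    have "(\<Sum>j\<in>UNIV. \<Sum>l\<in>UNIV. \<rho> $ (i, k) $ (j, l) * cnj (mat 1 $ i $ j * T $ k $ l))
        = (\<Sum>j\<in>UNIV. if i = j then \<Sum>l\<in>UNIV. \<rho> $ (i, k) $ (j, l) * cnj (T $ k $ l) else 0)"
      by (intro sum.cong) (auto simp: mat_def)
    then show ?thesis by simp
  qed
  then have "(\<Sum>p\<in>UNIV. \<Sum>q\<in>UNIV. \<rho> $ p $ q * cnj (kron (mat 1) T $ p $ q))
      = (\<Sum>i\<in>UNIV. \<Sum>k\<in>UNIV. \<Sum>l\<in>UNIV. \<rho> $ (i, k) $ (i, l) * cnj (T $ k $ l))"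
    by (simp add: sum_UNIV_prod kron_def)
  also have "\<dots> = (\<Sum>k\<in>UNIV. \<Sum>i\<in>UNIV. \<Sum>l\<in>UNIV. \<rho> $ (i, k) $ (i, l) * cnj (T $ k $ l))"
    by (rule sum.swap)
  also have "\<dots> = (\<Sum>k\<in>UNIV. \<Sum>l\<in>UNIV. \<Sum>i\<in>UNIV. \<rho> $ (i, k) $ (i, l) * cnj (T $ k $ l))"
    by (rule sum.cong[OF refl], rule sum.swap)
  also have "\<dots> = (\<Sum>k\<in>UNIV. \<Sum>l\<in>UNIV. partial_trace_A \<rho> $ k $ l * cnj (T $ k $ l))"
    by (simp add: partial_trace_A_def sum_distrib_right)
  finally show ?thesis by (simp add: inner_complex_matrix)
qed

lemma hermitian_partial_trace_B:
  assumes "hermitian \<rho>"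
  shows "hermitian (partial_trace_B \<rho>)"
proof -
  have "cnj (\<rho> $ p $ q) = \<rho> $ q $ p" for p q
    using assms unfolding hermitian_def by metis
  then show ?thesis by (simp add: hermitian_def partial_trace_B_def)
qed

lemma hermitian_partial_trace_A:
  assumes "hermitian \<rho>"
  shows "hermitian (partial_trace_A \<rho>)"
proof -
  have "cnj (\<rho> $ p $ q) = \<rho> $ q $ p" for p q
    using assms unfolding hermitian_def by metis
  then show ?thesis by (simp add: hermitian_def partial_trace_A_def)
qed

lemma psd_mat_1: "positive_semidefinite (mat 1)"
  by (rule psdI) (auto simp: cinner_self)

lemma psd_outer: "positive_semidefinite (outer w)"
  by (rule psdI) (auto simp: cinner_outer)

text \<open>By adjointness the form of the marginal at v is the inner product of \<rho> with
  \<open>kron (outer v) (mat 1)\<close>.\<close>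

lemma psd_partial_trace_B:
  assumes "positive_semidefinite \<rho>"
  shows "positive_semidefinite (partial_trace_B \<rho>)"
proof (rule psdI)
  show "Im (cinner v (partial_trace_B \<rho> *v v)) = 0" for v
    by (intro hermitian_quadratic_real hermitian_partial_trace_B psd_hermitian assms)
  show "Re (cinner v (partial_trace_B \<rho> *v v)) \<ge> 0" for v
    using psd_inner_kron_nonneg[OF assms psd_outer psd_mat_1]
    by (simp add: Re_cinner_matrix inner_kron_mat_1_right)
qed

lemma psd_partial_trace_A:
  assumes "positive_semidefinite \<rho>"
  shows "positive_semidefinite (partial_trace_A \<rho>)"
proof (rule psdI)
  show "Im (cinner v (partial_trace_A \<rho> *v v)) = 0" for v
    by (intro hermitian_quadratic_real hermitian_partial_trace_A psd_hermitian assms)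
  show "Re (cinner v (partial_trace_A \<rho> *v v)) \<ge> 0" for v
    using psd_inner_kron_nonneg[OF assms psd_mat_1 psd_outer]
    by (simp add: Re_cinner_matrix inner_kron_mat_1_left)
qed

section \<open>The upper bound\<close>

lemma D_bounds: "d \<ge> 2 \<Longrightarrow> 0 < D d" "d \<ge> 2 \<Longrightarrow> D d = 1 - 1 / real d"
  by (auto simp: D_def field_simps)

text \<open>In the coordinates \<open>u = sqrt (1 - x / D dA)\<close>, \<open>v = sqrt (1 - y / D dB)\<close> the case condition
  \<open>x \<le> r y\<close> becomes \<open>u + v \<ge> 1\<close>, and \<open>h - g = D dA * D dB * (u + v - 1)\<^sup>2\<close>.\<close>

lemma f_bound_eq:
  assumes d: "dA \<ge> 2" "dB \<ge> 2" and u: "0 \<le> u" "u \<le> 1" and v: "0 \<le> v" "v \<le> 1"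
  shows "f_bound dA dB (D dA * (1 - u\<^sup>2)) (D dB * (1 - v\<^sup>2)) =
    1 - (1 / (real dA * real dB) + D dA * u\<^sup>2 / real dB + D dB * v\<^sup>2 / real dA
      + D dA * D dB * (max 0 (u + v - 1))\<^sup>2)"
proof -
  have DA: "D dA > 0" and DB: "D dB > 0" using d by (auto simp: D_bounds)
  have su: "sqrt (1 - D dA * (1 - u\<^sup>2) / D dA) = u" and sv: "sqrt (1 - D dB * (1 - v\<^sup>2) / D dB) = v"
    and qv: "D dB * (1 - v\<^sup>2) / D dB = 1 - v\<^sup>2"
    using DA DB u v by auto
  have "r_bound dA dB (D dB * (1 - v\<^sup>2)) = D dA * (2 * v - v\<^sup>2)"
    unfolding r_bound_def sv unfolding qv by simp
  then have "D dA * (1 - u\<^sup>2) \<le> r_bound dA dB (D dB * (1 - v\<^sup>2)) \<longleftrightarrow> 1 - u\<^sup>2 \<le> 2 * v - v\<^sup>2"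
    using DA by simp
  also have "\<dots> \<longleftrightarrow> (1 - v)\<^sup>2 \<le> u\<^sup>2"
    by (simp add: power2_eq_square algebra_simps)
  also have "\<dots> \<longleftrightarrow> 1 \<le> u + v"
    using u v by (subst power_mono_iff) auto
  finally have r: "D dA * (1 - u\<^sup>2) \<le> r_bound dA dB (D dB * (1 - v\<^sup>2)) \<longleftrightarrow> 1 \<le> u + v" .
  have h: "h_bound dA dB (D dA * (1 - u\<^sup>2)) (D dB * (1 - v\<^sup>2)) =
      1 - (1 / (real dA * real dB) + D dA * u\<^sup>2 / real dB + D dB * v\<^sup>2 / real dA)"
    using d by (simp add: h_bound_def D_def field_simps)
  \<comment> \<open>Replacing 1 / d by 1 - D turns the identity for h - g into a polynomial one in
    \<open>D dA\<close>, \<open>D dB\<close>, u and v.\<close>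
  have iA: "1 / real dA = 1 - D dA" and iB: "1 / real dB = 1 - D dB"
    using d by (auto simp: D_bounds)
  have "g_bound dA dB (D dA * (1 - u\<^sup>2)) (D dB * (1 - v\<^sup>2)) =
      h_bound dA dB (D dA * (1 - u\<^sup>2)) (D dB * (1 - v\<^sup>2)) - D dA * D dB * (u + v - 1)\<^sup>2"
    unfolding g_bound_def h_bound_def su sv iA iB by (simp add: power2_eq_square algebra_simps)
  with r h show ?thesis
    by (auto simp: f_bound_def max_def)
qed

text \<open>Pythagoras: for trace 1 the subtracted multiple of the identity is the orthogonal
  projection of M onto the identity.\<close>

lemma norm_sub_maximally_mixed:
  fixes M :: "complex ^ 'n ^ 'n"
  assumes "trace M = 1"
  shows "(norm (M - (1 / real CARD('n)) *\<^sub>R mat 1))\<^sup>2 = (norm M)\<^sup>2 - 1 / real CARD('n)"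
    and "trace (M - (1 / real CARD('n)) *\<^sub>R mat 1) = 0"
    and "M \<bullet> (M - (1 / real CARD('n)) *\<^sub>R mat 1) = (norm M)\<^sup>2 - 1 / real CARD('n)"
proof -
  show "(norm (M - (1 / real CARD('n)) *\<^sub>R mat 1))\<^sup>2 = (norm M)\<^sup>2 - 1 / real CARD('n)"
    unfolding power2_norm_eq_inner inner_diff_left inner_diff_right
    using assms by (simp add: inner_commute[of "mat 1" M] inner_mat_1 trace_scaleR trace_mat_1)
  show "trace (M - (1 / real CARD('n)) *\<^sub>R mat 1) = 0"
    using assms by (simp add: trace_sub trace_scaleR trace_mat_1 scaleR_conv_of_real[where 'a = complex])
  show "M \<bullet> (M - (1 / real CARD('n)) *\<^sub>R mat 1) = (norm M)\<^sup>2 - 1 / real CARD('n)"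
    using assms by (simp add: inner_diff_right inner_mat_1 power2_norm_eq_inner)
qed

text \<open>By \<open>f_bound_eq\<close> the left side is 1 - f, so this is the entropy bound
  written for the purity.\<close>

lemma density_norm_lower_bound:
  fixes \<rho> :: "complex ^ ('a::finite \<times> 'b::finite) ^ ('a \<times> 'b)"
  assumes psd: "positive_semidefinite \<rho>" and tr: "trace \<rho> = 1"
    and d: "CARD('a) \<ge> 2" "CARD('b) \<ge> 2"
    and u: "0 \<le> u" "u \<le> 1" "(norm (partial_trace_B \<rho>))\<^sup>2 = 1 / real CARD('a) + D CARD('a) * u\<^sup>2"
    and v: "0 \<le> v" "v \<le> 1" "(norm (partial_trace_A \<rho>))\<^sup>2 = 1 / real CARD('b) + D CARD('b) * v\<^sup>2"
  shows "1 / (real CARD('a) * real CARD('b)) + D CARD('a) * u\<^sup>2 / real CARD('b)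
      + D CARD('b) * v\<^sup>2 / real CARD('a) + D CARD('a) * D CARD('b) * (max 0 (u + v - 1))\<^sup>2
    \<le> (norm \<rho>)\<^sup>2"
proof -
  define dA dB where "dA = real CARD('a)" and "dB = real CARD('b)"
  define DA DB where "DA = D CARD('a)" and "DB = D CARD('b)"
  have pos: "dA > 0" "dB > 0" "DA > 0" "DB > 0"
    using d by (auto simp: dA_def dB_def DA_def DB_def D_bounds)
  define \<alpha> where "\<alpha> = partial_trace_B \<rho> - (1 / dA) *\<^sub>R mat 1"
  define \<beta> where "\<beta> = partial_trace_A \<rho> - (1 / dB) *\<^sub>R mat 1"
  have trA: "trace (partial_trace_B \<rho>) = 1" and trB: "trace (partial_trace_A \<rho>) = 1"
    by (simp_all add: trace_partial_trace_A trace_partial_trace_B tr)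
  note mA = norm_sub_maximally_mixed[OF trA, folded dA_def, folded \<alpha>_def]
  note mB = norm_sub_maximally_mixed[OF trB, folded dB_def, folded \<beta>_def]
  have nA: "(norm \<alpha>)\<^sup>2 = DA * u\<^sup>2" and nB: "(norm \<beta>)\<^sup>2 = DB * v\<^sup>2"
    and iA: "partial_trace_B \<rho> \<bullet> \<alpha> = DA * u\<^sup>2" and iB: "partial_trace_A \<rho> \<bullet> \<beta> = DB * v\<^sup>2"
    and tA: "trace \<alpha> = 0" and tB: "trace \<beta> = 0"
    using mA mB u v by (simp_all add: dA_def dB_def DA_def DB_def)
  \<comment> \<open>Since \<alpha> and \<beta> are traceless, these four are pairwise orthogonal;
    adjointness reduces inner products with J, E and F to traces and marginals.\<close>
  define J E F K where "J = kron (mat 1 :: complex ^ 'a ^ 'a) (mat 1 :: complex ^ 'b ^ 'b)"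
    and "E = kron \<alpha> (mat 1 :: complex ^ 'b ^ 'b)"
    and "F = kron (mat 1 :: complex ^ 'a ^ 'a) \<beta>"
    and "K = kron \<alpha> \<beta>"
  have ptB: "partial_trace_B J = dB *\<^sub>R mat 1" "partial_trace_B E = dB *\<^sub>R \<alpha>"
    "partial_trace_B F = 0" "partial_trace_B K = 0"
    by (simp_all add: vec_eq_iff J_def E_def F_def K_def partial_trace_B_kron tB
        trace_mat_1 dB_def scaleR_conv_of_real[where 'a = complex])
  have ptA: "partial_trace_A J = dA *\<^sub>R mat 1" "partial_trace_A E = 0"
    "partial_trace_A F = dA *\<^sub>R \<beta>" "partial_trace_A K = 0"
    by (simp_all add: vec_eq_iff J_def E_def F_def K_def partial_trace_A_kron tA
        trace_mat_1 dA_def scaleR_conv_of_real[where 'a = complex])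
  have innerJ: "X \<bullet> J = Re (trace X)" and innerE: "X \<bullet> E = partial_trace_B X \<bullet> \<alpha>"
    and innerF: "X \<bullet> F = partial_trace_A X \<bullet> \<beta>" for X
    by (simp_all only: J_def E_def F_def inner_kron_mat_1_right inner_kron_mat_1_left
        kron_mat_1 inner_mat_1)
  have traces: "trace J = of_real (dA * dB)" "trace E = 0" "trace F = 0" "trace K = 0"
    by (simp_all add: trace_partial_trace_B[symmetric] ptB trace_scaleR trace_mat_1 tA
        dA_def dB_def scaleR_conv_of_real[where 'a = complex]) (simp_all add: trace_def)
  have mat_inner: "mat 1 \<bullet> \<alpha> = 0" "mat 1 \<bullet> \<beta> = 0"
    by (simp_all add: inner_commute[of "mat 1"] inner_mat_1 tA tB)
  have inners: "J \<bullet> J = dA * dB" "E \<bullet> E = dB * (DA * u\<^sup>2)" "F \<bullet> F = dA * (DB * v\<^sup>2)"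
    "J \<bullet> E = 0" "J \<bullet> F = 0" "E \<bullet> F = 0" "K \<bullet> J = 0" "K \<bullet> E = 0" "K \<bullet> F = 0"
    "\<rho> \<bullet> J = 1" "\<rho> \<bullet> E = DA * u\<^sup>2" "\<rho> \<bullet> F = DB * v\<^sup>2"
    by (simp_all add: innerJ innerE innerF traces ptA ptB mat_inner iA iB tr
        nA[unfolded power2_norm_eq_inner] nB[unfolded power2_norm_eq_inner])
  have inners': "E \<bullet> J = 0" "F \<bullet> J = 0" "F \<bullet> E = 0" "J \<bullet> K = 0" "E \<bullet> K = 0" "F \<bullet> K = 0"
    "J \<bullet> \<rho> = 1" "E \<bullet> \<rho> = DA * u\<^sup>2" "F \<bullet> \<rho> = DB * v\<^sup>2"
    using inners by (simp_all only: inner_commute)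
  note inners = inners inners'
  \<comment> \<open>The coefficients are those of the orthogonal projection of \<rho> onto the span
    of J, E and F.\<close>
  define \<gamma> where "\<gamma> = \<rho> - (1 / (dA * dB)) *\<^sub>R J - (1 / dB) *\<^sub>R E - (1 / dA) *\<^sub>R F"
  have "\<gamma> \<bullet> \<gamma> = \<rho> \<bullet> \<rho> - 1 / (dA * dB) - DA * u\<^sup>2 / dB - DB * v\<^sup>2 / dA"
    unfolding \<gamma>_def inner_diff_left inner_diff_right
    using pos by (simp add: inners)
  then have norm_\<rho>: "(norm \<rho>)\<^sup>2 = 1 / (dA * dB) + DA * u\<^sup>2 / dB + DB * v\<^sup>2 / dA + (norm \<gamma>)\<^sup>2"
    by (simp add: power2_norm_eq_inner)
  have "DA * DB * (max 0 (u + v - 1))\<^sup>2 \<le> (norm \<gamma>)\<^sup>2"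
  \<comment> \<open>As u and v are at most 1, u + v > 1 already forces both positive. Positivity
    later allows cancelling norm K; otherwise the maximum is 0.\<close>
  proof (cases "u + v > 1 \<and> u > 0 \<and> v > 0")
    case False
    then have "max 0 (u + v - 1) = 0" using u v by (auto simp: max_def)
    then show ?thesis by simp
  next
    case True
    define S where "S = (DA * u) *\<^sub>R mat 1 - \<alpha>"
    define T where "T = (DB * v) *\<^sub>R mat 1 - \<beta>"
    have norms: "norm \<alpha> = sqrt DA * u" "norm \<beta> = sqrt DB * v"
      using nA nB u v pos
      by (simp_all add: power_mult_distrib power2_eq_imp_eq)
    have SA: "sqrt DA * norm \<alpha> = DA * u" and SB: "sqrt DB * norm \<beta> = DB * v"
      using pos by (simp_all add: norms)
    have "hermitian \<alpha>" "hermitian \<beta>"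
      unfolding \<alpha>_def \<beta>_def
      by (intro hermitian_diff hermitian_scaleR_mat_1 hermitian_partial_trace_A
          hermitian_partial_trace_B psd_hermitian psd)+
    then have "positive_semidefinite S" "positive_semidefinite T"
      using traceless_le_norm_psd[of \<alpha>] traceless_le_norm_psd[of \<beta>] tA tB pos
      by (simp_all add: S_def T_def SA SB DA_def[symmetric] DB_def[symmetric])
    then have "0 \<le> \<rho> \<bullet> kron S T"
      by (rule psd_inner_kron_nonneg[OF psd])
    also have "kron S T = (DA * u * (DB * v)) *\<^sub>R J - (DA * u) *\<^sub>R F - (DB * v) *\<^sub>R E + K"
      by (simp add: S_def T_def kron_simps J_def E_def F_def K_def algebra_simps)
    also have "\<rho> \<bullet> \<dots> = DA * DB * (u * v) * (1 - u - v) + \<rho> \<bullet> K"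
      by (simp add: inner_add_right inner_diff_right inners power2_eq_square algebra_simps)
    \<comment> \<open>K is orthogonal to J, E and F, so it sees only the correlation part of
      \<rho>.\<close>
    also have "\<rho> \<bullet> K = \<gamma> \<bullet> K"
      by (simp add: \<gamma>_def inner_diff_left inners)
    also have "\<gamma> \<bullet> K \<le> norm \<gamma> * norm K"
      by (rule norm_cauchy_schwarz)
    also have "norm K = sqrt DA * sqrt DB * (u * v)"
      by (simp add: K_def norm_kron norms)
    \<comment> \<open>Each D is split into two square roots to expose norm K as a common positive
      factor.\<close>
    finally have "sqrt DA * sqrt DB * (u * v) * (sqrt DA * sqrt DB * (u + v - 1))
        \<le> sqrt DA * sqrt DB * (u * v) * norm \<gamma>"
      using pos by (simp add: algebra_simps)
    then have "sqrt DA * sqrt DB * (u + v - 1) \<le> norm \<gamma>"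
      using pos True by (simp add: mult_le_cancel_left_pos)
    then have "(sqrt DA * sqrt DB * (u + v - 1))\<^sup>2 \<le> (norm \<gamma>)\<^sup>2"
      using pos True by (intro power_mono) auto
    then show ?thesis using True pos by (simp add: power_mult_distrib)
  qed
  with norm_\<rho> show ?thesis by (simp add: dA_def dB_def DA_def DB_def)
qed

text \<open>u is the norm of the traceless part divided by \<open>sqrt (D d)\<close>; it ranges from
  0 (maximally mixed) to 1 (pure).\<close>

lemma linear_entropy_coordinate:
  fixes M :: "complex ^ 'n ^ 'n"
  assumes psd: "positive_semidefinite M" and tr: "trace M = 1" and d: "CARD('n) \<ge> 2"
  obtains u where "0 \<le> u" "u \<le> 1" "(norm M)\<^sup>2 = 1 / real CARD('n) + D CARD('n) * u\<^sup>2"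
    "linear_entropy M = D CARD('n) * (1 - u\<^sup>2)"
proof
  let ?q = "((norm M)\<^sup>2 - 1 / real CARD('n)) / D CARD('n)"
  note D = D_bounds[OF d]
  have "norm M \<le> 1"
    using psd_norm_le_trace[OF psd] tr by simp
  then have "(norm M)\<^sup>2 \<le> 1" by (simp add: power_le_one)
  then show "sqrt ?q \<le> 1" using D by simp
  have "0 \<le> (norm M)\<^sup>2 - 1 / real CARD('n)"
    using norm_sub_maximally_mixed(1)[OF tr] zero_le_power2 by metis
  then have q: "?q \<ge> 0" using D(1) by simp
  then show "sqrt ?q \<ge> 0" by simp
  have "D CARD('n) * (sqrt ?q)\<^sup>2 = (norm M)\<^sup>2 - 1 / real CARD('n)"
    using q D(1) by simp
  then show "(norm M)\<^sup>2 = 1 / real CARD('n) + D CARD('n) * (sqrt ?q)\<^sup>2"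
    "linear_entropy M = D CARD('n) * (1 - (sqrt ?q)\<^sup>2)"
    using D(2) by (simp_all add: linear_entropy_eq_norm[OF psd_hermitian[OF psd]] right_diff_distrib)
qed

lemma linear_entropy_le_f_bound:
  fixes \<rho> :: "complex ^ ('a::finite \<times> 'b::finite) ^ ('a \<times> 'b)"
  assumes "density_operator \<rho>" and d: "CARD('a) \<ge> 2" "CARD('b) \<ge> 2"
  shows "linear_entropy \<rho> \<le> f_bound CARD('a) CARD('b)
    (linear_entropy (partial_trace_B \<rho>)) (linear_entropy (partial_trace_A \<rho>))"
proof -
  have psd: "positive_semidefinite \<rho>" and tr: "trace \<rho> = 1"
    using assms by (auto simp: density_operator_def)
  obtain u where u: "0 \<le> u" "u \<le> 1"
    "(norm (partial_trace_B \<rho>))\<^sup>2 = 1 / real CARD('a) + D CARD('a) * u\<^sup>2"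
    "linear_entropy (partial_trace_B \<rho>) = D CARD('a) * (1 - u\<^sup>2)"
    using linear_entropy_coordinate[OF psd_partial_trace_B[OF psd]] tr d
    by (auto simp: trace_partial_trace_B)
  obtain v where v: "0 \<le> v" "v \<le> 1"
    "(norm (partial_trace_A \<rho>))\<^sup>2 = 1 / real CARD('b) + D CARD('b) * v\<^sup>2"
    "linear_entropy (partial_trace_A \<rho>) = D CARD('b) * (1 - v\<^sup>2)"
    using linear_entropy_coordinate[OF psd_partial_trace_A[OF psd]] tr d
    by (auto simp: trace_partial_trace_A)
  show ?thesis
    using density_norm_lower_bound[OF psd tr d u(1-3) v(1-3)]
    by (simp add: u(4) v(4) f_bound_eq[OF d u(1,2) v(1,2)]
        linear_entropy_eq_norm[OF psd_hermitian[OF psd]])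
qed

section \<open>Tightness\<close>

text \<open>Diagonal states reduce tightness to finding a joint probability distribution with
  prescribed sums of squares for itself and its marginals.\<close>

definition diag :: "('n::finite \<Rightarrow> real) \<Rightarrow> complex ^ 'n ^ 'n" where
  "diag p = (\<chi> i j. if i = j then of_real (p i) else 0)"

lemma hermitian_diag: "hermitian (diag p)"
  by (simp add: hermitian_def diag_def)

lemma density_operator_diag:
  assumes "\<And>i. p i \<ge> 0" "(\<Sum>i\<in>UNIV. p i) = 1"
  shows "density_operator (diag p)"
proof -
  have "diag p $ i $ j * v $ j = (if i = j then of_real (p i) * v $ j else 0)" for i j v
    by (simp add: diag_def)
  then have "cinner v (diag p *v v) = (\<Sum>i\<in>UNIV. of_real (p i * (cmod (v $ i))\<^sup>2))" for v
    by (simp add: cinner_def matrix_vector_mult_def complex_norm_square mult_ac del: of_real_power)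
  then have "cinner v (diag p *v v) = of_real (\<Sum>i\<in>UNIV. p i * (cmod (v $ i))\<^sup>2)" for v
    by simp
  then have "positive_semidefinite (diag p)"
    using assms(1) by (simp add: positive_semidefinite_def sum_nonneg del: of_real_sum)
  moreover have "trace (diag p) = 1"
    using assms(2) by (simp add: trace_def diag_def flip: of_real_sum)
  ultimately show ?thesis by (simp add: density_operator_def)
qed

lemma linear_entropy_diag: "linear_entropy (diag p) = 1 - (\<Sum>i\<in>UNIV. (p i)\<^sup>2)"
proof -
  have "(diag p $ i $ j) \<bullet> (diag p $ i $ j) = (if i = j then (p i)\<^sup>2 else 0)" for i j
    by (simp add: diag_def inner_complex_def power2_eq_square)
  then show ?thesis
    by (simp add: linear_entropy_eq_norm[OF hermitian_diag] power2_norm_eq_inner inner_vec_def)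
qed

lemma partial_trace_B_diag: "partial_trace_B (diag p) = diag (\<lambda>i. \<Sum>k\<in>UNIV. p (i, k))"
  by (simp add: partial_trace_B_def diag_def vec_eq_iff)

lemma partial_trace_A_diag: "partial_trace_A (diag p) = diag (\<lambda>k. \<Sum>i\<in>UNIV. p (i, k))"
  by (simp add: partial_trace_A_def diag_def vec_eq_iff)

text \<open>This is the diagonal of d times the projection onto basis vector a, minus the
  identity.\<close>

definition spike :: "'n::finite \<Rightarrow> 'n \<Rightarrow> real" where
  "spike a i = (if i = a then real CARD('n) - 1 else - 1)"

lemma sum_spike:
  fixes a :: "'n::finite"
  shows "(\<Sum>i\<in>UNIV. spike a i) = 0"
    and "(\<Sum>i\<in>UNIV. (spike a i)\<^sup>2) = real CARD('n) * (real CARD('n) - 1)"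
proof -
  have eq: "spike a i = (if i = a then real CARD('n) else 0) - 1" for i
    by (simp add: spike_def)
  show "(\<Sum>i\<in>UNIV. spike a i) = 0"
    by (simp add: eq sum_subtractf)
  have "(spike a i)\<^sup>2 = (if i = a then (real CARD('n))\<^sup>2 - 2 * real CARD('n) else 0) + 1" for i
    by (simp add: spike_def power2_eq_square algebra_simps)
  then show "(\<Sum>i\<in>UNIV. (spike a i)\<^sup>2) = real CARD('n) * (real CARD('n) - 1)"
    by (simp add: sum.distrib) (simp add: power2_eq_square algebra_simps)
qed

text \<open>Spikes sum to zero, so the linear and cross terms drop out.\<close>

lemma sum_affine_spike:
  fixes a :: "'n::finite"
  shows "(\<Sum>i\<in>UNIV. p + q * spike a i) = real CARD('n) * p"
    and "(\<Sum>i\<in>UNIV. (p + q * spike a i)\<^sup>2)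
      = real CARD('n) * p\<^sup>2 + real CARD('n) * (real CARD('n) - 1) * q\<^sup>2"
proof -
  show "(\<Sum>i\<in>UNIV. p + q * spike a i) = real CARD('n) * p"
    by (simp add: sum.distrib sum_distrib_left[symmetric] sum_spike)
  have "(p + q * spike a i)\<^sup>2 = p\<^sup>2 + 2 * p * q * spike a i + q\<^sup>2 * (spike a i)\<^sup>2" for i
    by (simp add: power2_eq_square algebra_simps)
  then show "(\<Sum>i\<in>UNIV. (p + q * spike a i)\<^sup>2)
      = real CARD('n) * p\<^sup>2 + real CARD('n) * (real CARD('n) - 1) * q\<^sup>2"
    by (simp add: sum.distrib sum_distrib_left[symmetric] sum_spike)
qed

text \<open>The coefficient \<open>max 0 (u + v - 1)\<close> of the correlation term is the smallest admissible one;
  for \<open>u + v \<ge> 1\<close> it makes the distribution vanish wherever both spikes are \<open>- 1\<close>.\<close>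

definition extremal_dist :: "real \<Rightarrow> real \<Rightarrow> 'a::finite \<Rightarrow> 'b::finite \<Rightarrow> 'a \<times> 'b \<Rightarrow> real" where
  "extremal_dist u v a b = (\<lambda>(i, k).
    ((1 + u * spike a i) + (v + max 0 (u + v - 1) * spike a i) * spike b k)
      / (real CARD('a) * real CARD('b)))"

lemma extremal_dist_nonneg:
  fixes a :: "'a::finite" and b :: "'b::finite"
  assumes u: "0 \<le> u" "u \<le> 1" and v: "0 \<le> v" "v \<le> 1"
  shows "extremal_dist u v a b p \<ge> 0"
proof (cases p)
  case (Pair i k)
  define c where "c = max 0 (u + v - 1)"
  have c: "c \<ge> 0" "c \<le> u" "c \<le> v" "1 - u - v + c \<ge> 0"
    using u v by (auto simp: c_def)
  have card: "real CARD('a) - 1 \<ge> 0" "real CARD('b) - 1 \<ge> 0"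
    by (simp_all add: Suc_leI)
  define m n where "m = real CARD('a) - 1" and "n = real CARD('b) - 1"
  have mn: "m \<ge> 0" "n \<ge> 0" using card by (auto simp: m_def n_def)
  \<comment> \<open>Up to the positive denominator, the four values are 1 + u m + v n + c m n, (1 -
    v) + (u - c) m, (1 - u) + (v - c) n and 1 - u - v + c.\<close>
  have prods: "0 \<le> u * m" "0 \<le> v * n" "0 \<le> c * m * n" "0 \<le> (u - c) * m" "0 \<le> (v - c) * n"
    using mn c u v by auto
  have "0 \<le> (1 + u * spike a i) + (v + c * spike a i) * spike b k"
    unfolding spike_def m_def[symmetric] n_def[symmetric]
    using prods c u v by (auto simp: algebra_simps)
  then show ?thesis
    by (simp add: extremal_dist_def Pair c_def)
qed

lemma extremal_dist_marginals:
  fixes a :: "'a::finite" and b :: "'b::finite"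
  shows "(\<Sum>k\<in>UNIV. extremal_dist u v a b (i, k)) = (1 + u * spike a i) / real CARD('a)"
    and "(\<Sum>i\<in>UNIV. extremal_dist u v a b (i, k)) = (1 + v * spike b k) / real CARD('b)"
proof -
  show "(\<Sum>k\<in>UNIV. extremal_dist u v a b (i, k)) = (1 + u * spike a i) / real CARD('a)"
    unfolding extremal_dist_def by (simp add: sum_affine_spike sum_divide_distrib[symmetric])
  define c where "c = max 0 (u + v - 1)"
  \<comment> \<open>The definition is affine in the spike of b; regrouping makes it affine in the
    spike of a, ready for summation over i.\<close>
  have "(\<Sum>i\<in>UNIV. extremal_dist u v a b (i, k)) =
    (\<Sum>i\<in>UNIV. (1 + v * spike b k) + (u + c * spike b k) * spike a i)
      / (real CARD('a) * real CARD('b))"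
    unfolding extremal_dist_def c_def[symmetric] sum_divide_distrib
    by (intro sum.cong) (simp_all add: algebra_simps)
  then show "(\<Sum>i\<in>UNIV. extremal_dist u v a b (i, k)) = (1 + v * spike b k) / real CARD('b)"
    by (simp add: sum_affine_spike)
qed

lemma sum_power2_affine_spike_normalized:
  fixes a :: "'n::finite"
  shows "(\<Sum>i\<in>UNIV. ((1 + u * spike a i) / real CARD('n))\<^sup>2) = 1 / real CARD('n) + D CARD('n) * u\<^sup>2"
  by (simp add: power_divide sum_divide_distrib[symmetric] sum_affine_spike D_def)
    (simp add: field_simps power2_eq_square)

text \<open>Summing over one index and then the other removes all cross terms; the result equals the
  lower bound in \<open>density_norm_lower_bound\<close>.\<close>

lemma sum_power2_extremal_dist:
  fixes a :: "'a::finite" and b :: "'b::finite"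
  shows "(\<Sum>p\<in>UNIV. (extremal_dist u v a b p)\<^sup>2) =
    1 / (real CARD('a) * real CARD('b)) + D CARD('a) * u\<^sup>2 / real CARD('b)
      + D CARD('b) * v\<^sup>2 / real CARD('a) + D CARD('a) * D CARD('b) * (max 0 (u + v - 1))\<^sup>2"
  unfolding sum_UNIV_prod extremal_dist_def D_def
  by (simp add: power_divide sum_divide_distrib[symmetric] sum_affine_spike sum.distrib
      sum_distrib_left[symmetric])
    (simp add: field_simps power2_eq_square)

lemma f_bound_attained:
  assumes d: "CARD('a::finite) \<ge> 2" "CARD('b::finite) \<ge> 2"
    and x: "x \<in> {0..D CARD('a)}" and y: "y \<in> {0..D CARD('b)}"
  shows "\<exists>\<rho> :: complex ^ ('a \<times> 'b) ^ ('a \<times> 'b). density_operator \<rho>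
    \<and> linear_entropy (partial_trace_B \<rho>) = x
    \<and> linear_entropy (partial_trace_A \<rho>) = y
    \<and> linear_entropy \<rho> = f_bound CARD('a) CARD('b) x y"
proof -
  note D = D_bounds[OF d(1)] D_bounds[OF d(2)]
  \<comment> \<open>u and v invert x = D (1 - u^2) and y = D (1 - v^2), the coordinates of
    \<open>f_bound_eq\<close>.\<close>
  define u where "u = sqrt (1 - x / D CARD('a))"
  define v where "v = sqrt (1 - y / D CARD('b))"
  have u: "0 \<le> u" "u \<le> 1" and v: "0 \<le> v" "v \<le> 1"
    using D x y by (auto simp: u_def v_def)
  have xu: "D CARD('a) * (1 - u\<^sup>2) = x" and yv: "D CARD('b) * (1 - v\<^sup>2) = y"
    using D(1,3) x y by (auto simp: u_def v_def)
  \<comment> \<open>\<open>undefined\<close> serves as an arbitrary basis index on each side; any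
    position of the spikes works.\<close>
  let ?p = "extremal_dist u v (undefined :: 'a) (undefined :: 'b)"
  have "(\<Sum>p\<in>UNIV. ?p p) = 1"
    by (simp add: sum_UNIV_prod extremal_dist_marginals sum_affine_spike
        sum_divide_distrib[symmetric])
  then have "density_operator (diag ?p)"
    by (intro density_operator_diag extremal_dist_nonneg u v)
  moreover have "linear_entropy (partial_trace_B (diag ?p)) = x"
    unfolding partial_trace_B_diag linear_entropy_diag extremal_dist_marginals
      sum_power2_affine_spike_normalized
    using xu D(2) by (simp add: right_diff_distrib)
  moreover have "linear_entropy (partial_trace_A (diag ?p)) = y"
    unfolding partial_trace_A_diag linear_entropy_diag extremal_dist_marginals
      sum_power2_affine_spike_normalized
    using yv D(4) by (simp add: right_diff_distrib)
  moreover have "linear_entropy (diag ?p) = f_bound CARD('a) CARD('b) x y"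
    using f_bound_eq[OF d u v] by (simp add: xu yv linear_entropy_diag sum_power2_extremal_dist)
  ultimately show ?thesis by blast
qed

theorem theorem4:
  assumes "CARD('a::finite) \<ge> 2" and "CARD('b::finite) \<ge> 2"
  shows "(\<forall>\<rho> :: complex ^ ('a \<times> 'b) ^ ('a \<times> 'b). density_operator \<rho> \<longrightarrow>
            linear_entropy \<rho> \<le> f_bound CARD('a) CARD('b)
              (linear_entropy (partial_trace_B \<rho>)) (linear_entropy (partial_trace_A \<rho>)))
       \<and> (\<forall>a \<in> {0..D CARD('a)}. \<forall>b \<in> {0..D CARD('b)}.
            \<exists>\<rho> :: complex ^ ('a \<times> 'b) ^ ('a \<times> 'b). density_operator \<rho>
              \<and> linear_entropy (partial_trace_B \<rho>) = a
              \<and> linear_entropy (partial_trace_A \<rho>) = b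
              \<and> linear_entropy \<rho> = f_bound CARD('a) CARD('b) a b)"
  using linear_entropy_le_f_bound[OF _ assms] f_bound_attained[OF assms] by blast

end
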